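(* The quantity $\hat\sigma_n=\hat\sigma_n(t):=-\sum_{j=0}^{n-1}R_j(t)$ satisfies the second-order difference equation $$2\left(n\hat\sigma_{n-1}+\hat\sigma_n-n\hat\sigma_{n+1}\right)^2-2\gamma\left(n\hat\sigma_{n-1}+\hat\sigma_n-n\hat\sigma_{n+1}\right)\left(t-\hat\sigma_{n-1}+\hat\sigma_{n+1}\right)$$ $$=(\hat\sigma_{n-1}-\hat\sigma_n)(\hat\sigma_n-\hat\sigma_{n+1})(\hat\sigma_n+nt)(\hat\sigma_{n+1}-\hat\sigma_{n-1}+t),$$ which is a discrete $\sigma$-form equation.
   Context: Let $A\ge 0$, $A+B\ge 0$, $\gamma>-1$. For $t\in\mathbb{R}$ let $w(z)=w(z,t,\gamma)=e^{-z^2+tz}|z-t|^{\gamma}(A+B\theta(z-t))$ for $z\in\mathbb{R}$, where $\theta(x)=1$ for $x>0$ and $\theta(x)=0$ for $x\le 0$. Let $P_n(z)=P_n(z,t,\gamma)$ be the monic polynomials of degree $n$ orthogonal with respect to $w$: $\int_{\mathbb{R}}P_jP_i\,w\,dz=h_j\delta_{ij}$, with $h_n=h_n(t)$. Define $$R_n(t)=\frac{\gamma}{h_n}\int_{\mathbb{R}}\frac{P_n^2(y)w(y)}{y-t}\,dy .$$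
   Formalization: For −1<γ≤0 the integral defining R_n generally diverges at y=t; there γ∫P_n²w/(y−t)dy is read as its Hadamard finite part (the principal value if B=0; at γ=0 the limit as γ decreases to 0). For γ>0 the definition is as stated. *)

theory Defs
  imports "HOL-Analysis.Analysis" "HOL-Computational_Algebra.Polynomial"
begin

definition heaviside :: "real \<Rightarrow> real" where
  "heaviside x = (if x > 0 then 1 else 0)"

definition weight :: "real \<Rightarrow> real \<Rightarrow> real \<Rightarrow> real \<Rightarrow> real \<Rightarrow> real" where
  "weight A B \<gamma> t z =
     exp (- z\<^sup>2 + t * z) * \<bar>z - t\<bar> powr \<gamma> * (A + B * heaviside (z - t))"

definition monic_orthogonal ::
    "(real \<Rightarrow> real) \<Rightarrow> (nat \<Rightarrow> real poly) \<Rightarrow> (nat \<Rightarrow> real) \<Rightarrow> bool" where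
  "monic_orthogonal w P h \<longleftrightarrow>
     (\<forall>n. degree (P n) = n \<and> lead_coeff (P n) = 1) \<and>
     (\<forall>i j. (LINT z|lborel. poly (P j) z * poly (P i) z * w z) = (if i = j then h j else 0))"

text \<open>
  For \<open>\<gamma> > 0\<close>, the quantity \<open>(\<gamma> / h\<^sub>n) \<integral> P\<^sub>n(y)\<^sup>2 w(y) / (y - t) dy\<close> is given by an absolutely
  convergent integral.  For \<open>-1 < \<gamma> \<le> 0\<close> the integrand is in general not integrable at \<open>y = t\<close>
  (and the Lebesgue integral of the library would then be 0), so \<open>\<gamma> \<integral> \<dots>\<close> is read as its
  Hadamard finite part.  Since \<open>\<gamma> \<bar>y - t\<bar> powr \<gamma> / (y - t)\<close> is the derivative of
  \<open>\<bar>y - t\<bar> powr \<gamma>\<close>, integration by parts over \<open>\<bar>y - t\<bar> > \<epsilon>\<close> leaves the boundary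
  contribution \<open>- B * \<epsilon> powr \<gamma> * P\<^sub>n(t)\<^sup>2 + O(\<epsilon> powr (\<gamma> + 1))\<close> (note \<open>exp (- t\<^sup>2 + t * t) = 1\<close>),
  and the finite part is obtained by removing the first term.  For \<open>B = 0\<close> this is the Cauchy
  principal value, for \<open>\<gamma> > 0\<close> the removed term tends to 0 and the limit would be the ordinary
  integral, and for \<open>\<gamma> = 0\<close> the value \<open>B * P\<^sub>n(t)\<^sup>2\<close> is the limit of \<open>\<gamma> \<integral> \<dots>\<close> as \<open>\<gamma>\<close> decreases to 0.
\<close>

definition R_coeff ::
    "real \<Rightarrow> real \<Rightarrow> real \<Rightarrow> real \<Rightarrow> (nat \<Rightarrow> real poly) \<Rightarrow> (nat \<Rightarrow> real) \<Rightarrow> nat \<Rightarrow> real" where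
  "R_coeff A B \<gamma> t P h n =
     (if \<gamma> > 0 then
        \<gamma> / h n * (LINT y|lborel. (poly (P n) y)\<^sup>2 * weight A B \<gamma> t y / (y - t))
      else
        1 / h n * Lim (at_right 0) (\<lambda>\<epsilon>.
          \<gamma> * (LINT y:{y. \<bar>y - t\<bar> > \<epsilon>}|lborel. (poly (P n) y)\<^sup>2 * weight A B \<gamma> t y / (y - t))
          + B * \<epsilon> powr \<gamma> * (poly (P n) t)\<^sup>2))"

definition sigma_hat ::
    "real \<Rightarrow> real \<Rightarrow> real \<Rightarrow> real \<Rightarrow> (nat \<Rightarrow> real poly) \<Rightarrow> (nat \<Rightarrow> real) \<Rightarrow> nat \<Rightarrow> real" where
  "sigma_hat A B \<gamma> t P h n = - (\<Sum>j<n. R_coeff A B \<gamma> t P h j)"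

end

theory Submission
  imports Defs "HOL-Real_Asymp.Real_Asymp"
begin

text \<open>
  Integration by parts identifies the (finite part) integral \<open>\<gamma> \<integral> f(y) w(y) / (y - t) dy\<close>, for a
  polynomial \<open>f\<close>, with \<open>D f = \<integral> ((2 y - t) f(y) - f'(y)) w(y) dy\<close>, which only involves moments of \<open>w\<close>;
  in particular \<open>D ((y - t) f) = \<gamma> \<integral> f w\<close>.  Let \<open>\<beta> = h\<^sub>n / h\<^sub>n\<^sub>-\<^sub>1\<close>.  By orthogonality \<open>\<sigma>\<^sub>n = n t + 2 p\<^sub>n\<close>,
  where \<open>p\<^sub>n\<close> is the subleading coefficient of \<open>P\<^sub>n\<close>, and \<open>r := D (P\<^sub>n P\<^sub>n\<^sub>-\<^sub>1) / h\<^sub>n\<^sub>-\<^sub>1 = 2 \<beta> - n\<close>.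
  Splitting off the value at \<open>t\<close> of one factor, \<open>D (P\<^sub>n q) = q(t) D P\<^sub>n\<close> for \<open>deg q \<le> n\<close>, which yields
  \<open>r\<^sup>2 - \<gamma> r = \<beta> R\<^sub>n R\<^sub>n\<^sub>-\<^sub>1\<close>, while \<open>D ((y - t) P\<^sub>n P\<^sub>n\<^sub>-\<^sub>1) = 0\<close> yields \<open>2 \<beta> Y = \<sigma>\<^sub>n + n t\<close> with
  \<open>Y = t - \<sigma>\<^sub>n\<^sub>-\<^sub>1 + \<sigma>\<^sub>n\<^sub>+\<^sub>1\<close>.  Multiplying the first identity by \<open>2 Y\<^sup>2\<close> and eliminating \<open>\<beta>\<close> gives the
  difference equation.
\<close>

subsection \<open>Orthogonal polynomials for a semiclassical functional\<close>

text \<open>The algebra depends on the weight only through its moment functional \<open>L\<close>.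
  \<open>pearson\<close> is the weak form of (y - t) w' = ((t - 2 y) (y - t) + \<gamma>) w, tested
  against polynomials \<open>f\<close>; the factor y - t removes the singularity of w'/w.\<close>

locale semiclassical_functional =
  fixes L :: "real poly \<Rightarrow> real" and P :: "nat \<Rightarrow> real poly" and h :: "nat \<Rightarrow> real"
    and t \<gamma> :: real
  assumes L_add: "L (p + q) = L p + L q"
    and L_smult: "L (smult c p) = c * L p"
    and degree_P: "degree (P n) = n"
    and lead_coeff_P: "lead_coeff (P n) = 1"
    and orthogonal: "L (P i * P j) = (if i = j then h j else 0)"
    and pearson: "L ([:- t, 2:] * ([:- t, 1:] * f) - pderiv ([:- t, 1:] * f)) = \<gamma> * L f"
begin

section \<open>Orthogonality as extraction of coefficients\<close>

lemma L_diff: "L (p - q) = L p - L q"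
  using L_add[of p "smult (-1) q"] L_smult[of "-1" q] by simp

lemma L_0: "L 0 = 0"
  using L_smult[of 0 0] by simp

lemma coeff_P: "coeff (P n) n = 1"
  using lead_coeff_P[of n] by (simp add: degree_P)

lemma coeff_P_Suc: "coeff (P n) (Suc n) = 0" "coeff (P n) (Suc (Suc n)) = 0"
  by (simp_all add: coeff_eq_0 degree_P)

text \<open>Induction on a degree bound: subtracting the right multiple of \<open>P (Suc m)\<close>
  removes the top coefficient of \<open>q\<close>.\<close>

lemma L_P_lower:
  assumes "degree q < n"
  shows "L (P n * q) = 0"
proof -
  have "L (P n * q) = 0" if "degree q \<le> m" "m < n" for m q
    using that
  proof (induction m arbitrary: q)
    case 0
    have "q = smult (coeff q 0) (P 0)"
      using 0 degree_P[of 0] coeff_P[of 0] by (auto elim!: degree_eq_zeroE)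
    then have "L (P n * q) = coeff q 0 * L (P n * P 0)"
      by (metis L_smult mult_smult_right)
    then show ?case
      using 0 by (simp add: orthogonal)
  next
    case (Suc m)
    define q' where "q' = q - smult (coeff q (Suc m)) (P (Suc m))"
    have "degree q' \<le> Suc m"
      unfolding q'_def using Suc.prems
      by (intro degree_diff_le) (auto simp: degree_P intro: order.trans[OF degree_smult_le])
    moreover have "coeff q' (Suc m) = 0"
      by (simp add: q'_def coeff_P)
    ultimately have "degree q' \<le> m"
      by (metis le_SucE leading_coeff_0_iff degree_0 zero_le)
    then have "L (P n * q') = 0"
      using Suc by simp
    moreover have "P n * q = P n * q' + smult (coeff q (Suc m)) (P n * P (Suc m))"
      by (simp add: q'_def algebra_simps)
    ultimately show ?case
      using Suc.prems by (simp add: L_add L_smult orthogonal)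
  qed
  then show ?thesis
    using assms by blast
qed

lemma L_P_same:
  assumes "degree q \<le> n"
  shows "L (P n * q) = coeff q n * h n"
proof -
  define q' where "q' = q - smult (coeff q n) (P n)"
  have "degree q' \<le> n"
    unfolding q'_def using assms
    by (intro degree_diff_le) (auto simp: degree_P intro: order.trans[OF degree_smult_le])
  moreover have "coeff q' n = 0"
    by (simp add: q'_def coeff_P)
  \<comment> \<open>The disjunct \<open>q' = 0\<close> covers n = 0, where no degree lies below
    n.\<close>
  ultimately have "q' = 0 \<or> degree q' < n"
    by (metis le_neq_implies_less leading_coeff_0_iff)
  then have "L (P n * q') = 0"
    using L_P_lower L_0 by auto
  moreover have "P n * q = P n * q' + smult (coeff q n) (P n * P n)"
    by (simp add: q'_def algebra_simps)
  ultimately show ?thesis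
    by (simp add: L_add L_smult orthogonal)
qed

text \<open>The coefficient of y^(n-1) in \<open>P n\<close>; the shift by \<open>pCons 0\<close>
  makes it 0 at n = 0 without a case distinction.\<close>

definition subleading :: "nat \<Rightarrow> real" where
  "subleading n = coeff (pCons 0 (P n)) n"

lemma subleading_0: "subleading 0 = 0"
  by (simp add: subleading_def)

lemma coeff_P_subleading: "coeff (P (Suc n)) n = subleading (Suc n)"
  by (simp add: subleading_def)

text \<open>Removing the top term of \<open>q\<close> by a multiple of \<open>P (Suc n)\<close>
  costs nothing under \<open>L\<close> but shifts the coefficient at n by the subleading coefficient
  of \<open>P (Suc n)\<close>.\<close>

lemma L_P_upper:
  assumes "degree q \<le> Suc n"
  shows "L (P n * q) = (coeff q n - coeff q (Suc n) * subleading (Suc n)) * h n"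
proof -
  define q' where "q' = q - smult (coeff q (Suc n)) (P (Suc n))"
  have "degree q' \<le> Suc n"
    unfolding q'_def using assms
    by (intro degree_diff_le) (auto simp: degree_P intro: order.trans[OF degree_smult_le])
  moreover have "coeff q' (Suc n) = 0"
    by (simp add: q'_def coeff_P)
  ultimately have "degree q' \<le> n"
    by (metis le_SucE leading_coeff_0_iff degree_0 zero_le)
  then have "L (P n * q') = coeff q' n * h n"
    by (rule L_P_same)
  moreover have "P n * q = P n * q' + smult (coeff q (Suc n)) (P n * P (Suc n))"
    by (simp add: q'_def algebra_simps)
  ultimately show ?thesis
    by (simp add: L_add L_smult orthogonal q'_def coeff_P_subleading)
qed

text \<open>
  For the weight of the theorem, \<open>D f\<close> is \<open>\<gamma>\<close> times the (finite part) integral of \<open>f(y) w(y) / (y - t)\<close>.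
\<close>

definition D :: "real poly \<Rightarrow> real" where
  "D f = L ([:- t, 2:] * f - pderiv f)"

section \<open>Algebra of the functional \<open>D\<close>\<close>

lemma D_add: "D (p + q) = D p + D q"
proof -
  have "[:- t, 2:] * (p + q) - pderiv (p + q)
      = ([:- t, 2:] * p - pderiv p) + ([:- t, 2:] * q - pderiv q)"
    by (simp only: pderiv_add distrib_left add_diff_add)
  then show ?thesis
    unfolding D_def by (metis L_add)
qed

lemma D_smult: "D (smult c p) = c * D p"
proof -
  have "[:- t, 2:] * smult c p - pderiv (smult c p) = smult c ([:- t, 2:] * p - pderiv p)"
    by (simp add: pderiv_smult smult_diff_right)
  then show ?thesis
    unfolding D_def by (metis L_smult)
qed

lemma D_shift: "D ([:- t, 1:] * f) = \<gamma> * L f"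
  unfolding D_def by (rule pearson)

text \<open>Division of \<open>q\<close> by y - t: the remainder is \<open>poly q t\<close>, and
  \<open>D_shift\<close> turns the quotient part into a plain value of \<open>L\<close>.\<close>

lemma D_P_mult: "D (P n * q) = poly q t * D (P n) + \<gamma> * L (P n * synthetic_div q t)"
proof -
  have "P n * q = smult (poly q t) (P n) + [:- t, 1:] * (P n * synthetic_div q t)"
    by (subst synthetic_div_correct'[of t q, symmetric]) (simp add: algebra_simps)
  then show ?thesis
    by (simp only: D_add D_smult D_shift)
qed

text \<open>The quotient of \<open>q\<close> by y - t is zero or has degree below n, so
  orthogonality removes its contribution.\<close>

lemma D_P_mult_le:
  assumes "degree q \<le> n"
  shows "D (P n * q) = poly q t * D (P n)"
proof (cases "degree q = 0")
  case True
  then have "synthetic_div q t = 0"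
    by (simp add: synthetic_div_eq_0_iff)
  then show ?thesis
    by (simp add: D_P_mult L_0)
next
  case False
  then have "degree (synthetic_div q t) < n"
    using assms by (simp add: degree_synthetic_div)
  then show ?thesis
    by (simp add: D_P_mult L_P_lower)
qed

text \<open>Here the quotient by y - t is monic of degree exactly n, so it contributes \<gamma>
  \<open>h n\<close>; this is the source of the term linear in r in the compatibility
  condition.\<close>

lemma D_P_Suc: "D (P n * P (Suc n)) = poly (P (Suc n)) t * D (P n) + \<gamma> * h n"
proof -
  let ?q = "synthetic_div (P (Suc n)) t"
  have deg: "degree ?q = n"
    by (simp add: degree_synthetic_div degree_P)
  have "coeff (P (Suc n)) (Suc n) = coeff ([:- t, 1:] * ?q + [:poly (P (Suc n)) t:]) (Suc n)"
    by (simp only: synthetic_div_correct')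
  then have "coeff ?q n = 1"
    using deg by (simp add: coeff_P coeff_eq_0)
  then show ?thesis
    by (simp add: D_P_mult L_P_same deg)
qed

text \<open>
  In the notation of ladder operators, with \<open>R\<^sub>n = D (P\<^sub>n P\<^sub>n) / h\<^sub>n\<close>, \<open>r\<^sub>n = D (P\<^sub>n P\<^sub>n\<^sub>-\<^sub>1) / h\<^sub>n\<^sub>-\<^sub>1\<close> and
  \<open>\<beta>\<^sub>n = h\<^sub>n / h\<^sub>n\<^sub>-\<^sub>1\<close>, this is the compatibility condition \<open>r\<^sub>n\<^sup>2 - \<gamma> r\<^sub>n = \<beta>\<^sub>n R\<^sub>n R\<^sub>n\<^sub>-\<^sub>1\<close>.
\<close>

lemma D_P_product:
  "(D (P (Suc n) * P n))\<^sup>2 - \<gamma> * h n * D (P (Suc n) * P n)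
     = D (P (Suc n) * P (Suc n)) * D (P n * P n)"
proof -
  have 1: "D (P (Suc n) * P n) = poly (P n) t * D (P (Suc n))"
    by (intro D_P_mult_le) (simp add: degree_P)
  have 2: "D (P (Suc n) * P n) - \<gamma> * h n = poly (P (Suc n)) t * D (P n)"
    using D_P_Suc[of n] by (simp add: mult.commute)
  have 3: "D (P k * P k) = poly (P k) t * D (P k)" for k
    by (intro D_P_mult_le) (simp add: degree_P)
  have "(D (P (Suc n) * P n))\<^sup>2 - \<gamma> * h n * D (P (Suc n) * P n)
      = D (P (Suc n) * P n) * (D (P (Suc n) * P n) - \<gamma> * h n)"
    by (simp add: power2_eq_square algebra_simps)
  also have "\<dots> = (poly (P n) t * D (P (Suc n))) * (poly (P (Suc n)) t * D (P n))"
    by (simp only: 2) (simp only: 1)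
  finally show ?thesis
    by (simp add: 3)
qed

section \<open>Values of \<open>D\<close> in terms of norms and subleading coefficients\<close>

lemma coeff_linear_mult: "coeff ([:a, b:] * q) k = a * coeff q k + b * coeff (pCons 0 q) k"
  by (cases k) simp_all

lemma degree_linear_mult: "degree ([:a, b:] * q) \<le> Suc (degree q)"
  by (rule order.trans[OF degree_mult_le]) simp

text \<open>The derivative part pairs \<open>P n\<close> with lower degree and vanishes. The rest
  has degree n + 1 against \<open>P n\<close>, which brings in two consecutive subleading
  coefficients.\<close>

lemma D_P_square: "D (P n * P n) = (2 * (subleading n - subleading (Suc n)) - t) * h n"
proof -
  have "[:- t, 2:] * (P n * P n) - pderiv (P n * P n)
      = P n * ([:- t, 2:] * P n) - P n * (pderiv (P n) + pderiv (P n))"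
    by (simp only: pderiv_mult) (simp only: algebra_simps)
  moreover have "L (P n * ([:- t, 2:] * P n)) = (2 * (subleading n - subleading (Suc n)) - t) * h n"
    using degree_linear_mult[of "- t" 2 "P n"]
    by (subst L_P_upper)
      (simp_all add: degree_P coeff_linear_mult coeff_P coeff_P_Suc subleading_def right_diff_distrib
        del: mult_pCons_left mult_pCons_right)
  moreover have "L (P n * pderiv (P n)) = 0"
    using degree_P[of n] by (cases "n = 0")
      (auto simp: L_0 degree_pderiv pderiv_eq_0_iff[THEN iffD2] intro!: L_P_lower)
  ultimately show ?thesis
    by (simp only: D_def L_diff L_add distrib_left)
qed

lemma degree_P_mult_pderiv: "degree (pderiv (P (Suc n))) = n"
  by (simp add: degree_pderiv degree_P)

text \<open>Of the two terms of the product rule only \<open>P n * pderiv (P (Suc n))\<close>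
  survives, through its leading coefficient n + 1.\<close>

lemma D_P_adjacent: "D (P (Suc n) * P n) = 2 * h (Suc n) - real (Suc n) * h n"
proof -
  have "[:- t, 2:] * (P (Suc n) * P n) - pderiv (P (Suc n) * P n)
      = P (Suc n) * ([:- t, 2:] * P n) - (P (Suc n) * pderiv (P n) + P n * pderiv (P (Suc n)))"
    by (simp add: pderiv_mult algebra_simps)
  moreover have "L (P (Suc n) * ([:- t, 2:] * P n)) = 2 * h (Suc n)"
    using degree_linear_mult[of "- t" 2 "P n"]
    by (subst L_P_same) (auto simp: degree_P coeff_P coeff_eq_0)
  moreover have "L (P (Suc n) * pderiv (P n)) = 0"
    by (intro L_P_lower) (simp add: degree_pderiv degree_P)
  moreover have "L (P n * pderiv (P (Suc n))) = real (Suc n) * h n"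
    by (simp add: L_P_same degree_P_mult_pderiv coeff_pderiv coeff_P)
  ultimately show ?thesis
    by (simp only: D_def L_diff L_add)
qed

text \<open>This is \<open>pearson\<close> for \<open>P (Suc n) * P n\<close>, whose right-hand side
  vanishes by orthogonality, with the left-hand side evaluated by coefficients.\<close>

lemma subleading_relation:
  "(2 * (subleading n - subleading (Suc (Suc n))) - 3 * t) * h (Suc n) + (subleading (Suc n) + real (Suc n) * t) * h n = 0"
proof -
  let ?X = "[:- t, 1:]"
  \<comment> \<open>The grouping keeps the degree of each cofactor at most one above the index of
    the orthogonal polynomial it meets, so \<open>L_P_upper\<close> and \<open>L_P_lower\<close>
    suffice.\<close>
  have "[:- t, 2:] * (?X * (P (Suc n) * P n)) - pderiv (?X * (P (Suc n) * P n))
      = P (Suc n) * ([:- t, 2:] * (?X * P n))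
        - (P (Suc n) * pderiv (?X * P n) + P n * (?X * pderiv (P (Suc n))))"
    by (simp only: pderiv_mult) (simp only: algebra_simps)
  moreover have "L (P (Suc n) * ([:- t, 2:] * (?X * P n)))
      = (2 * (subleading n - subleading (Suc (Suc n))) - 3 * t) * h (Suc n)"
  proof (subst L_P_upper)
    show "degree ([:- t, 2:] * (?X * P n)) \<le> Suc (Suc n)"
      by (metis degree_linear_mult degree_P Suc_le_mono order.trans)
    have "coeff ([:- t, 2:] * (?X * P n)) (Suc (Suc n)) = 2"
      by (simp add: coeff_linear_mult coeff_P coeff_P_Suc del: mult_pCons_left mult_pCons_right)
    moreover have "coeff ([:- t, 2:] * (?X * P n)) (Suc n) = 2 * subleading n - 3 * t"
      by (simp add: coeff_linear_mult coeff_P coeff_P_Suc subleading_def del: mult_pCons_left mult_pCons_right)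
    ultimately show "(coeff ([:- t, 2:] * (?X * P n)) (Suc n)
        - coeff ([:- t, 2:] * (?X * P n)) (Suc (Suc n)) * subleading (Suc (Suc n))) * h (Suc n)
      = (2 * (subleading n - subleading (Suc (Suc n))) - 3 * t) * h (Suc n)"
      by (simp only:) (simp add: algebra_simps)
  qed
  moreover have "L (P (Suc n) * pderiv (?X * P n)) = 0"
    using degree_linear_mult[of "- t" 1 "P n"]
    by (intro L_P_lower) (simp add: degree_pderiv degree_P del: mult_pCons_left mult_pCons_right)
  moreover have "L (P n * (?X * pderiv (P (Suc n)))) = (- subleading (Suc n) - real (Suc n) * t) * h n"
  proof (subst L_P_upper)
    show "degree (?X * pderiv (P (Suc n))) \<le> Suc n"
      by (metis degree_linear_mult degree_P_mult_pderiv)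
    have "coeff (?X * pderiv (P (Suc n))) (Suc n) = real (Suc n)"
      by (simp add: coeff_linear_mult coeff_P coeff_P_Suc coeff_pderiv del: mult_pCons_left mult_pCons_right)
    moreover have "coeff (?X * pderiv (P (Suc n))) n = real n * subleading (Suc n) - t * real (Suc n)"
      by (cases n) (simp_all add: coeff_linear_mult coeff_P subleading_def coeff_pderiv del: mult_pCons_left mult_pCons_right)
    ultimately show "(coeff (?X * pderiv (P (Suc n))) n
        - coeff (?X * pderiv (P (Suc n))) (Suc n) * subleading (Suc n)) * h n
      = (- subleading (Suc n) - real (Suc n) * t) * h n"
      by (simp only:) (simp add: algebra_simps)
  qed
  moreover have "L (P (Suc n) * P n) = 0"
    by (simp add: orthogonal)
  ultimately have "(2 * (subleading n - subleading (Suc (Suc n))) - 3 * t) * h (Suc n)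
      - (0 + (- subleading (Suc n) - real (Suc n) * t) * h n) = 0"
    using pearson[of "P (Suc n) * P n"] by (simp only: L_diff L_add mult_zero_right)
  then show ?thesis
    by (simp add: algebra_simps)
qed

section \<open>Telescoping and the difference equation\<close>

lemma sum_D_P:
  assumes "\<And>j. h j \<noteq> 0"
  shows "- (\<Sum>j<n. D (P j * P j) / h j) = 2 * subleading n + real n * t"
proof (induction n)
  case (Suc n)
  have "D (P n * P n) / h n = 2 * (subleading n - subleading (Suc n)) - t"
    using assms by (simp add: D_P_square)
  then show ?case
    using Suc by (simp add: algebra_simps)
qed (simp add: subleading_0)

lemma discrete_sigma_form:
  assumes h: "\<And>j. h j \<noteq> 0" and n: "n \<ge> 1"
  defines "\<sigma> \<equiv> \<lambda>n. - (\<Sum>j<n. D (P j * P j) / h j)"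
  shows "2 * (real n * \<sigma> (n - 1) + \<sigma> n - real n * \<sigma> (n + 1))\<^sup>2
         - 2 * \<gamma> * (real n * \<sigma> (n - 1) + \<sigma> n - real n * \<sigma> (n + 1)) * (t - \<sigma> (n - 1) + \<sigma> (n + 1))
       = (\<sigma> (n - 1) - \<sigma> n) * (\<sigma> n - \<sigma> (n + 1)) * (\<sigma> n + real n * t) * (\<sigma> (n + 1) - \<sigma> (n - 1) + t)"
proof -
  obtain m where m: "n = Suc m"
    using n by (cases n) auto
  have \<sigma>: "\<sigma> k = 2 * subleading k + real k * t" for k
    unfolding \<sigma>_def by (rule sum_D_P[OF h])
  \<comment> \<open>\<open>b\<close> is the recurrence coefficient \<beta> and \<open>r\<close> the
    normalised value of \<open>D (P n * P m)\<close>. \<open>X\<close> and \<open>Y\<close> are the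
    two combinations in the claim.\<close>
  define b r X Y where "b = h n / h m" and "r = 2 * b - real n"
    and "X = real n * \<sigma> m + \<sigma> n - real n * \<sigma> (Suc n)"
    and "Y = t - \<sigma> m + \<sigma> (Suc n)"
  have hn: "h n = b * h m"
    using h[of m] by (simp add: b_def)
  have "(r * h m)\<^sup>2 - \<gamma> * h m * (r * h m)
      = ((\<sigma> n - \<sigma> (Suc n)) * (b * h m)) * ((\<sigma> m - \<sigma> n) * h m)"
  proof -
    have "D (P n * P m) = r * h m"
      using D_P_adjacent[of m] by (simp add: m[symmetric] r_def hn left_diff_distrib)
    moreover have "D (P n * P n) = (\<sigma> n - \<sigma> (Suc n)) * (b * h m)"
      by (simp add: D_P_square \<sigma> hn algebra_simps)
    moreover have "D (P m * P m) = (\<sigma> m - \<sigma> n) * h m"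
      by (simp add: D_P_square \<sigma> m algebra_simps)
    ultimately show ?thesis
      using D_P_product[of m] by (simp only: m)
  qed
  then have "(r\<^sup>2 - \<gamma> * r) * (h m)\<^sup>2 = (b * (\<sigma> n - \<sigma> (Suc n)) * (\<sigma> m - \<sigma> n)) * (h m)\<^sup>2"
    by (simp add: power2_eq_square algebra_simps)
  then have E1: "r\<^sup>2 - \<gamma> * r = b * (\<sigma> n - \<sigma> (Suc n)) * (\<sigma> m - \<sigma> n)"
    using h[of m] by simp
  have "(2 * (subleading m - subleading (Suc n)) - 3 * t) * b + (subleading n + real n * t) = 0"
  proof -
    have "((2 * (subleading m - subleading (Suc n)) - 3 * t) * b + (subleading n + real n * t)) * h m = 0"
      using subleading_relation[of m] by (simp add: m[symmetric] hn algebra_simps)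
    then show ?thesis
      using h[of m] by simp
  qed
  \<comment> \<open>In terms of \<sigma> the coefficient of \<open>b\<close> is \<open>- Y\<close>;
    doubling turns the remaining term into \<sigma> n + n t.\<close>
  then have E2: "2 * b * Y = \<sigma> n + real n * t"
    by (simp add: Y_def \<sigma> m algebra_simps)
  \<comment> \<open>r Y = 2 b Y - n Y, and the terms n t cancel.\<close>
  then have E3: "r * Y = X"
    by (simp add: r_def X_def Y_def algebra_simps)
  \<comment> \<open>One factor \<open>Y\<close> combines with 2 b by \<open>E2\<close>, which
    eliminates \<open>b\<close>; the other remains as the last factor. There is no division by
    \<open>Y\<close>.\<close>
  have "2 * X\<^sup>2 - 2 * \<gamma> * X * Y = 2 * Y\<^sup>2 * (r\<^sup>2 - \<gamma> * r)"
    by (simp add: E3[symmetric] power2_eq_square algebra_simps)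
  also have "\<dots> = (\<sigma> m - \<sigma> n) * (\<sigma> n - \<sigma> (Suc n)) * (2 * b * Y) * Y"
    by (simp only: E1) (simp add: power2_eq_square)
  also have "\<dots> = (\<sigma> m - \<sigma> n) * (\<sigma> n - \<sigma> (Suc n)) * (\<sigma> n + real n * t) * Y"
    by (simp only: E2)
  also have "\<dots> = (\<sigma> m - \<sigma> n) * (\<sigma> n - \<sigma> (Suc n)) * (\<sigma> n + real n * t) * (\<sigma> (Suc n) - \<sigma> m + t)"
    by (simp add: Y_def)
  finally show ?thesis
    unfolding X_def Y_def by (simp only: m Suc_eq_plus1 diff_add_inverse2)
qed

end

subsection \<open>Integration against the weight\<close>

lemma borel_measurable_poly [measurable]: "poly p \<in> borel_measurable (borel :: real measure)"
  by (intro borel_measurable_continuous_onI continuous_intros)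

text \<open>The weight without its jump factor A + B \<theta>(y - t). That factor is constant on
  each side of t, so calculus is done for this function first.\<close>

definition gauss_powr :: "real \<Rightarrow> real \<Rightarrow> real \<Rightarrow> real" where
  "gauss_powr \<gamma> t y = exp (- y\<^sup>2 + t * y) * \<bar>y - t\<bar> powr \<gamma>"

lemma weight_eq: "weight A B \<gamma> t y = (A + B * heaviside (y - t)) * gauss_powr \<gamma> t y"
  by (simp add: weight_def gauss_powr_def)

lemma poly_exp_bound:
  fixes p :: "real poly"
  shows "\<exists>C k. C \<ge> 0 \<and> (\<forall>z. \<bar>poly p z\<bar> \<le> C * exp (real k * \<bar>z\<bar>))"
proof (induction p)
  case (pCons a p)
  then obtain C k where C: "C \<ge> 0" "\<And>z. \<bar>poly p z\<bar> \<le> C * exp (real k * \<bar>z\<bar>)"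
    by blast
  have "\<bar>poly (pCons a p) z\<bar> \<le> (\<bar>a\<bar> + C) * exp (real (Suc k) * \<bar>z\<bar>)" for z
  proof -
    have "\<bar>z\<bar> \<le> exp \<bar>z\<bar>"
      using exp_ge_add_one_self[of "\<bar>z\<bar>"] by linarith
    then have "\<bar>z\<bar> * \<bar>poly p z\<bar> \<le> exp \<bar>z\<bar> * (C * exp (real k * \<bar>z\<bar>))"
      using C by (intro mult_mono) auto
    also have "\<dots> = C * exp (real (Suc k) * \<bar>z\<bar>)"
      by (simp add: exp_add[symmetric] algebra_simps)
    finally have "\<bar>z * poly p z\<bar> \<le> C * exp (real (Suc k) * \<bar>z\<bar>)"
      by (simp add: abs_mult)
    moreover have "\<bar>a\<bar> * 1 \<le> \<bar>a\<bar> * exp (real (Suc k) * \<bar>z\<bar>)"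
      by (intro mult_left_mono) simp_all
    ultimately show ?thesis
      using abs_triangle_ineq[of a "z * poly p z"] by (simp add: distrib_right)
  qed
  then show ?case
    using C(1) by (intro exI[of _ "\<bar>a\<bar> + C"] exI[of _ "Suc k"]) auto
qed (auto intro!: exI[of _ 0])

text \<open>The quadratic exponent beats any linear one. The bound is centred at t to match the
  singular factor.\<close>

lemma poly_gauss_bound:
  fixes p :: "real poly" and t :: real
  shows "\<exists>C\<ge>0. \<forall>z. \<bar>poly p z * exp (- z\<^sup>2 + t * z)\<bar> \<le> C * exp (- \<bar>z - t\<bar>)"
proof -
  obtain C k where C: "C \<ge> 0" "\<And>z. \<bar>poly p z\<bar> \<le> C * exp (real k * \<bar>z\<bar>)"
    using poly_exp_bound by blast
  \<comment> \<open>The slope collects k from the polynomial, |t| from t z and 1 from |z -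
    t|.\<close>
  define c where "c = real k + \<bar>t\<bar> + 1"
  have "\<bar>poly p z * exp (- z\<^sup>2 + t * z)\<bar> \<le> C * exp (c\<^sup>2 + \<bar>t\<bar>) * exp (- \<bar>z - t\<bar>)" for z
  proof -
    have "t * z \<le> \<bar>t\<bar> * \<bar>z\<bar>"
      by (metis abs_ge_self abs_mult)
    then have "real k * \<bar>z\<bar> + t * z + \<bar>z - t\<bar> \<le> c * \<bar>z\<bar> + \<bar>t\<bar>"
      using abs_triangle_ineq4[of z t] by (simp add: c_def algebra_simps)
    moreover have "c * \<bar>z\<bar> \<le> z\<^sup>2 + c\<^sup>2"
      using sum_squares_bound[of c "\<bar>z\<bar>"] zero_le_power2[of c] zero_le_power2[of z]
      unfolding power2_abs by linarith
    ultimately have "real k * \<bar>z\<bar> + (- z\<^sup>2 + t * z) + \<bar>z - t\<bar> \<le> c\<^sup>2 + \<bar>t\<bar>"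
      by linarith
    then have "exp (real k * \<bar>z\<bar> + (- z\<^sup>2 + t * z)) \<le> exp (c\<^sup>2 + \<bar>t\<bar> + - \<bar>z - t\<bar>)"
      by simp
    then have "C * (exp (real k * \<bar>z\<bar>) * exp (- z\<^sup>2 + t * z)) \<le> C * (exp (c\<^sup>2 + \<bar>t\<bar>) * exp (- \<bar>z - t\<bar>))"
      using C(1) unfolding exp_add by (rule mult_left_mono)
    moreover have "\<bar>poly p z\<bar> * exp (- z\<^sup>2 + t * z) \<le> C * exp (real k * \<bar>z\<bar>) * exp (- z\<^sup>2 + t * z)"
      using C(2) by (rule mult_right_mono) simp
    ultimately show ?thesis
      unfolding abs_mult abs_exp_cancel mult.assoc by (rule order.trans[rotated])
  qed
  then show ?thesis
    using C(1) by (intro exI[of _ "C * exp (c\<^sup>2 + \<bar>t\<bar>)"]) simp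
qed

text \<open>The function is the sum of two mirrored copies of the integrand of Gamma(\<gamma> + 1),
  glued at t.\<close>

lemma integrable_powr_exp:
  fixes \<gamma> t :: real
  assumes "\<gamma> > -1"
  shows "integrable lborel (\<lambda>y. \<bar>y - t\<bar> powr \<gamma> * exp (- \<bar>y - t\<bar>))"
proof -
  define g :: "real \<Rightarrow> real" where "g u = indicator {0..} u * (u powr \<gamma> / exp u)" for u
  have "(\<lambda>u. u powr \<gamma> / exp u) integrable_on {0..}"
    using Gamma_integral_real[of "\<gamma> + 1"] assms by auto
  then have "(\<lambda>u. u powr \<gamma> / exp u) absolutely_integrable_on {0..}"
    by (intro nonnegative_absolutely_integrable_1) auto
  then have "integrable lebesgue g"
    by (simp add: set_integrable_def g_def[abs_def])
  moreover have "g \<in> borel_measurable lborel"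
    unfolding g_def by measurable
  ultimately have g: "integrable lborel g"
    by (simp add: integrable_completion)
  have "integrable lborel (\<lambda>y. g (- t + 1 * y) + g (t + (- 1) * y))"
    by (intro Bochner_Integration.integrable_add lborel_integrable_real_affine g) simp_all
  \<comment> \<open>At y = t both copies overlap, but \<open>0 powr \<gamma> = 0\<close> for every
    \<gamma>.\<close>
  moreover have "g (- t + 1 * y) + g (t + (- 1) * y) = \<bar>y - t\<bar> powr \<gamma> * exp (- \<bar>y - t\<bar>)" for y
    by (cases y t rule: linorder_cases) (auto simp: g_def divide_inverse exp_minus[symmetric])
  ultimately show ?thesis
    by simp
qed

lemma integrable_poly_gauss_powr:
  fixes \<gamma> t :: real
  assumes "\<gamma> > -1"
  shows "integrable lborel (\<lambda>y. poly p y * gauss_powr \<gamma> t y)"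
proof -
  obtain C where C: "C \<ge> 0" "\<And>z. \<bar>poly p z * exp (- z\<^sup>2 + t * z)\<bar> \<le> C * exp (- \<bar>z - t\<bar>)"
    using poly_gauss_bound by blast
  show ?thesis
    unfolding gauss_powr_def mult.assoc[symmetric]
  proof (rule Bochner_Integration.integrable_bound)
    show "integrable lborel (\<lambda>y. C * (\<bar>y - t\<bar> powr \<gamma> * exp (- \<bar>y - t\<bar>)))"
      by (intro integrable_mult_right integrable_powr_exp assms)
    show "AE y in lborel. norm (poly p y * exp (- y\<^sup>2 + t * y) * \<bar>y - t\<bar> powr \<gamma>)
        \<le> norm (C * (\<bar>y - t\<bar> powr \<gamma> * exp (- \<bar>y - t\<bar>)))"
    proof (rule AE_I2)
      fix y
      have "\<bar>poly p y * exp (- y\<^sup>2 + t * y)\<bar> * \<bar>y - t\<bar> powr \<gamma>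
          \<le> (C * exp (- \<bar>y - t\<bar>)) * \<bar>y - t\<bar> powr \<gamma>"
        using C(2) by (rule mult_right_mono) simp
      then show "norm (poly p y * exp (- y\<^sup>2 + t * y) * \<bar>y - t\<bar> powr \<gamma>)
          \<le> norm (C * (\<bar>y - t\<bar> powr \<gamma> * exp (- \<bar>y - t\<bar>)))"
        using C(1) by (simp add: abs_mult mult_ac)
    qed
  qed measurable
qed

lemma abs_weight_factor_le: "\<bar>A + B * heaviside x\<bar> \<le> \<bar>A\<bar> + \<bar>B\<bar>"
  by (auto simp: heaviside_def)

lemma integrable_bounded_mult:
  fixes f c :: "real \<Rightarrow> real"
  assumes "integrable lborel f" and [measurable]: "c \<in> borel_measurable borel"
    and "\<And>x. \<bar>c x\<bar> \<le> K"
  shows "integrable lborel (\<lambda>x. f x * c x)"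
proof (rule Bochner_Integration.integrable_bound)
  show "integrable lborel (\<lambda>x. K * f x)"
    using assms(1) by simp
  show "(\<lambda>x. f x * c x) \<in> borel_measurable lborel"
    using assms(1) by measurable
  show "AE x in lborel. norm (f x * c x) \<le> norm (K * f x)"
  proof (rule AE_I2)
    fix x
    have "\<bar>f x\<bar> * \<bar>c x\<bar> \<le> \<bar>f x\<bar> * \<bar>K\<bar>"
      using assms(3)[of x] by (intro mult_left_mono) auto
    then show "norm (f x * c x) \<le> norm (K * f x)"
      by (simp add: abs_mult mult.commute)
  qed
qed

lemma integrable_poly_weight:
  assumes "\<gamma> > -1"
  shows "integrable lborel (\<lambda>y. poly p y * weight A B \<gamma> t y)"
proof -
  have "integrable lborel (\<lambda>y. poly p y * gauss_powr \<gamma> t y * (A + B * heaviside (y - t)))"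
    by (rule integrable_bounded_mult[OF integrable_poly_gauss_powr[OF assms] _ abs_weight_factor_le])
      (unfold heaviside_def, measurable)
  then show ?thesis
    by (simp add: weight_eq mult_ac)
qed

section \<open>Truncated integrals and integration by parts\<close>

lemma tendsto_set_integral_punctured:
  fixes g :: "real \<Rightarrow> real"
  assumes g: "integrable lborel g"
  shows "((\<lambda>\<epsilon>. LINT y:{y. \<bar>y - t\<bar> > \<epsilon>}|lborel. g y) \<longlongrightarrow> (LINT y|lborel. g y)) (at_right 0)"
  \<comment> \<open>The substitution \<epsilon> = 1/i allows dominated convergence at infinity, with
    |g| as the bound; pointwise convergence is only claimed off the null set {t}.\<close>
  unfolding filterlim_at_right_to_top set_lebesgue_integral_def
proof (rule integral_dominated_convergence_at_top[where w = "\<lambda>y. \<bar>g y\<bar>"])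
  have [measurable]: "g \<in> borel_measurable borel"
    using g by simp
  show "g \<in> borel_measurable lborel"
    by simp
  show "(\<lambda>x. indicator {y. \<bar>y - t\<bar> > inverse i} x *\<^sub>R g x) \<in> borel_measurable lborel" for i :: real
    by measurable
  show "integrable lborel (\<lambda>y. \<bar>g y\<bar>)"
    using g by simp
  show "\<forall>\<^sub>F i in at_top. AE x in lborel.
      norm (indicator {y. \<bar>y - t\<bar> > inverse i} x *\<^sub>R g x) \<le> \<bar>g x\<bar>"
    by (intro always_eventually allI AE_I2) (auto simp: indicator_def)
  have pointwise: "((\<lambda>i. indicator {y. \<bar>y - t\<bar> > inverse i} x *\<^sub>R g x) \<longlongrightarrow> g x) at_top" if "x \<noteq> t" for x
  proof (rule tendsto_eventually)
    have "\<forall>\<^sub>F i in at_top. inverse i < \<bar>x - t\<bar>"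
      using that by (intro order_tendstoD(2)[OF tendsto_inverse_0_at_top[OF filterlim_ident]]) simp
    then show "\<forall>\<^sub>F i in at_top. indicator {y. \<bar>y - t\<bar> > inverse i} x *\<^sub>R g x = g x"
      by eventually_elim simp
  qed
  show "AE x in lborel. ((\<lambda>i. indicator {y. \<bar>y - t\<bar> > inverse i} x *\<^sub>R g x) \<longlongrightarrow> g x) at_top"
    by (rule eventually_mono[OF AE_lborel_singleton[of t]]) (rule pointwise)
qed

lemma has_real_derivative_abs_powr:
  fixes y t \<gamma> :: real
  assumes "y \<noteq> t"
  shows "((\<lambda>y. \<bar>y - t\<bar> powr \<gamma>) has_real_derivative \<gamma> * \<bar>y - t\<bar> powr \<gamma> / (y - t)) (at y)"
proof (cases "y > t")
  case True
  have "((\<lambda>y. (y - t) powr \<gamma>) has_real_derivative \<gamma> * (y - t) powr \<gamma> / (y - t)) (at y)"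
    using True by (auto intro!: derivative_eq_intros simp: powr_diff)
  moreover have "\<forall>\<^sub>F y in nhds y. (y - t) powr \<gamma> = \<bar>y - t\<bar> powr \<gamma>"
    using eventually_nhds_in_open[of "{t<..}" y] True by (auto elim!: eventually_mono)
  ultimately show ?thesis
    using True by (subst DERIV_cong_ev[OF refl _ refl]) (auto elim: eventually_mono)
next
  case False
  then have "y < t"
    using assms by simp
  then have "((\<lambda>y. (t - y) powr \<gamma>) has_real_derivative \<gamma> * (t - y) powr \<gamma> / (y - t)) (at y)"
    by (auto intro!: derivative_eq_intros simp: powr_diff field_simps)
  moreover have "\<forall>\<^sub>F y in nhds y. (t - y) powr \<gamma> = \<bar>y - t\<bar> powr \<gamma>"
    using eventually_nhds_in_open[of "{..<t}" y] \<open>y < t\<close> by (auto elim!: eventually_mono)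
  ultimately show ?thesis
    using \<open>y < t\<close> by (subst DERIV_cong_ev[OF refl _ refl]) (auto elim: eventually_mono)
qed

lemma tendsto_poly_gauss_powr:
  fixes \<gamma> t :: real
  assumes "filterlim (\<lambda>y. \<bar>y - t\<bar>) at_top F"
  shows "((\<lambda>y. poly p y * gauss_powr \<gamma> t y) \<longlongrightarrow> 0) F"
proof -
  obtain C where C: "\<And>z. \<bar>poly p z * exp (- z\<^sup>2 + t * z)\<bar> \<le> C * exp (- \<bar>z - t\<bar>)"
    using poly_gauss_bound by blast
  have "((\<lambda>u :: real. C * exp (- u) * u powr \<gamma>) \<longlongrightarrow> 0) at_top"
    by real_asymp
  then have "((\<lambda>y. C * exp (- \<bar>y - t\<bar>) * \<bar>y - t\<bar> powr \<gamma>) \<longlongrightarrow> 0) F"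
    by (rule filterlim_compose[OF _ assms])
  then show ?thesis
    unfolding gauss_powr_def mult.assoc[symmetric]
    by (rule Lim_null_comparison[rotated])
      (auto simp: abs_mult intro!: always_eventually mult_right_mono C[simplified abs_mult, simplified])
qed


text \<open>The product rule, arranged to show both the singular integrand of R and the polynomial
  that defines \<open>D\<close>.\<close>

lemma has_real_derivative_poly_gauss_powr:
  assumes "y \<noteq> t"
  shows "((\<lambda>y. poly f y * gauss_powr \<gamma> t y) has_real_derivative
    \<gamma> * (poly f y * gauss_powr \<gamma> t y / (y - t))
    - poly ([:- t, 2:] * f - pderiv f) y * gauss_powr \<gamma> t y) (at y)"
proof -
  have "((\<lambda>y. poly f y * (exp (- y\<^sup>2 + t * y) * \<bar>y - t\<bar> powr \<gamma>)) has_real_derivative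
      poly f y * (exp (- y\<^sup>2 + t * y) * (\<gamma> * \<bar>y - t\<bar> powr \<gamma> / (y - t))
        + (t - 2 * y) * exp (- y\<^sup>2 + t * y) * \<bar>y - t\<bar> powr \<gamma>)
      + poly (pderiv f) y * (exp (- y\<^sup>2 + t * y) * \<bar>y - t\<bar> powr \<gamma>)) (at y)"
    by (rule derivative_eq_intros poly_DERIV has_real_derivative_abs_powr[OF assms] refl)+
      (simp add: algebra_simps)
  then show ?thesis
    unfolding gauss_powr_def
    by (rule DERIV_cong) (simp add: algebra_simps)
qed

lemma set_integrable_punctured_div:
  fixes g :: "real \<Rightarrow> real"
  assumes g: "integrable lborel g" and "\<epsilon> > 0"
  shows "set_integrable lborel {y. \<bar>y - t\<bar> > \<epsilon>} (\<lambda>y. g y / (y - t))"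
proof -
  have "integrable lborel (\<lambda>y. g y * (indicator {y. \<bar>y - t\<bar> > \<epsilon>} y / (y - t)))"
  proof (rule integrable_bounded_mult[OF g])
    show "\<bar>indicator {y. \<bar>y - t\<bar> > \<epsilon>} x / (x - t)\<bar> \<le> 1 / \<epsilon>" for x
      using \<open>\<epsilon> > 0\<close> by (auto simp: indicator_def abs_divide intro!: divide_left_mono mult_pos_pos)
  qed measurable
  then show ?thesis
    by (simp add: set_integrable_def mult.commute)
qed

lemma isCont_poly_gauss_powr: "y \<noteq> t \<Longrightarrow> isCont (\<lambda>y. poly f y * gauss_powr \<gamma> t y) y"
  using has_real_derivative_poly_gauss_powr DERIV_isCont by blast

text \<open>The fundamental theorem on each half-line separately, because the jump factor differs
  there; the boundary terms at infinity vanish by Gaussian decay.\<close>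

lemma integral_derivative_poly_gauss_powr:
  fixes \<gamma> t \<epsilon> :: real and f :: "real poly"
  assumes "\<gamma> > -1" and "\<epsilon> > 0"
  defines "F \<equiv> \<lambda>y. poly f y * gauss_powr \<gamma> t y"
    and "F' \<equiv> \<lambda>y. \<gamma> * (poly f y * gauss_powr \<gamma> t y / (y - t))
      - poly ([:- t, 2:] * f - pderiv f) y * gauss_powr \<gamma> t y"
  shows "set_integrable lborel {y. \<bar>y - t\<bar> > \<epsilon>} F'"
    and "(LINT y:{t + \<epsilon><..}|lborel. F' y) = - F (t + \<epsilon>)"
    and "(LINT y:{..<t - \<epsilon>}|lborel. F' y) = F (t - \<epsilon>)"
proof -
  let ?S = "{y. \<bar>y - t\<bar> > \<epsilon>}"
  show int: "set_integrable lborel ?S F'"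
    unfolding F'_def
  proof (intro set_integral_diff(1) set_integrable_mult_right set_integrable_punctured_div
      integrable_poly_gauss_powr assms)
    have "set_integrable lborel UNIV (\<lambda>y. poly ([:- t, 2:] * f - pderiv f) y * gauss_powr \<gamma> t y)"
      using integrable_poly_gauss_powr[OF assms(1), of "[:- t, 2:] * f - pderiv f" t] by (simp add: set_integrable_def)
    then show "set_integrable lborel ?S (\<lambda>y. poly ([:- t, 2:] * f - pderiv f) y * gauss_powr \<gamma> t y)"
      by (rule set_integrable_subset) auto
  qed
  have deriv: "(F has_vector_derivative F' y) (at y)" if "y \<noteq> t" for y
    using has_real_derivative_poly_gauss_powr[OF that, of f \<gamma>]
    by (simp add: F_def F'_def has_real_derivative_iff_has_vector_derivative)
  have cont: "isCont F' y" if "y \<noteq> t" for y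
    unfolding F'_def using that by (intro continuous_intros isCont_poly_gauss_powr) auto
  have lim: "(F \<longlongrightarrow> 0) at_top" "(F \<longlongrightarrow> 0) at_bot"
    unfolding F_def by (rule tendsto_poly_gauss_powr; real_asymp)+
  have contF: "isCont F y" if "y \<noteq> t" for y
    unfolding F_def using that by (rule isCont_poly_gauss_powr)
  have "(LBINT y=ereal (t + \<epsilon>)..\<infinity>. F' y) = 0 - F (t + \<epsilon>)"
  proof (rule interval_integral_FTC_integrable)
    show "set_integrable lborel (einterval (ereal (t + \<epsilon>)) \<infinity>) F'"
      using int by (rule set_integrable_subset) (auto simp: einterval_def)
    show "((F \<circ> real_of_ereal) \<longlongrightarrow> F (t + \<epsilon>)) (at_right (ereal (t + \<epsilon>)))"
      using contF[of "t + \<epsilon>"] \<open>\<epsilon> > 0\<close>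
      by (simp add: ereal_tendsto_simps filterlim_at_split isCont_def)
    show "((F \<circ> real_of_ereal) \<longlongrightarrow> 0) (at_left \<infinity>)"
      using lim(1) by (simp add: ereal_tendsto_simps)
  qed (use \<open>\<epsilon> > 0\<close> in \<open>auto intro!: deriv cont\<close>)
  then show "(LINT y:{t + \<epsilon><..}|lborel. F' y) = - F (t + \<epsilon>)"
    by (simp add: interval_integral_to_infinity_eq)
  have "(LBINT y=-\<infinity>..ereal (t - \<epsilon>). F' y) = F (t - \<epsilon>) - 0"
  proof (rule interval_integral_FTC_integrable)
    show "set_integrable lborel (einterval (-\<infinity>) (ereal (t - \<epsilon>))) F'"
      using int by (rule set_integrable_subset) (auto simp: einterval_def)
    show "((F \<circ> real_of_ereal) \<longlongrightarrow> F (t - \<epsilon>)) (at_left (ereal (t - \<epsilon>)))"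
      using contF[of "t - \<epsilon>"] \<open>\<epsilon> > 0\<close>
      by (simp add: ereal_tendsto_simps filterlim_at_split isCont_def)
    show "((F \<circ> real_of_ereal) \<longlongrightarrow> 0) (at_right (-\<infinity>))"
      using lim(2) by (simp add: ereal_tendsto_simps)
  qed (use \<open>\<epsilon> > 0\<close> in \<open>auto intro!: deriv cont\<close>)
  then show "(LINT y:{..<t - \<epsilon>}|lborel. F' y) = F (t - \<epsilon>)"
    by (simp add: interval_lebesgue_integral_def einterval_def lessThan_def)
qed

text \<open>The two half-line identities are added with the constant values of the jump factor, A on
  the left and A + B on the right.\<close>

lemma truncated_integration_by_parts:
  fixes \<gamma> t \<epsilon> :: real
  assumes "\<gamma> > -1" and "\<epsilon> > 0"
  shows "\<gamma> * (LINT y:{y. \<bar>y - t\<bar> > \<epsilon>}|lborel. poly f y * weight A B \<gamma> t y / (y - t))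
    = (LINT y:{y. \<bar>y - t\<bar> > \<epsilon>}|lborel. poly ([:- t, 2:] * f - pderiv f) y * weight A B \<gamma> t y)
      + A * (poly f (t - \<epsilon>) * gauss_powr \<gamma> t (t - \<epsilon>))
      - (A + B) * (poly f (t + \<epsilon>) * gauss_powr \<gamma> t (t + \<epsilon>))"
proof -
  let ?S = "{y. \<bar>y - t\<bar> > \<epsilon>}" and ?q = "[:- t, 2:] * f - pderiv f"
  define c where "c y = A + B * heaviside (y - t)" for y
  define F' where "F' y = \<gamma> * (poly f y * gauss_powr \<gamma> t y / (y - t)) - poly ?q y * gauss_powr \<gamma> t y" for y
  have S: "?S = {..<t - \<epsilon>} \<union> {t + \<epsilon><..}"
    by auto
  note parts = integral_derivative_poly_gauss_powr[OF assms, of t f, folded F'_def[abs_def]]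
  have int1: "set_integrable lborel ?S (\<lambda>y. poly f y * weight A B \<gamma> t y / (y - t))"
    by (intro set_integrable_punctured_div integrable_poly_weight assms)
  then have int1': "set_integrable lborel ?S (\<lambda>y. \<gamma> * (poly f y * weight A B \<gamma> t y / (y - t)))"
    by (rule set_integrable_mult_right)
  have int2: "set_integrable lborel ?S (\<lambda>y. poly ?q y * weight A B \<gamma> t y)"
  proof (rule set_integrable_subset)
    show "set_integrable lborel UNIV (\<lambda>y. poly ?q y * weight A B \<gamma> t y)"
      using integrable_poly_weight[OF assms(1), of ?q A B t] by (simp add: set_integrable_def)
  qed auto
  have "(LINT y:?S|lborel. \<gamma> * (poly f y * weight A B \<gamma> t y / (y - t)) - poly ?q y * weight A B \<gamma> t y)
      = \<gamma> * (LINT y:?S|lborel. poly f y * weight A B \<gamma> t y / (y - t))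
        - (LINT y:?S|lborel. poly ?q y * weight A B \<gamma> t y)"
    using int1' int2 by (simp only: set_integral_diff(2) set_integral_mult_right)
  moreover have "(LINT y:?S|lborel. \<gamma> * (poly f y * weight A B \<gamma> t y / (y - t)) - poly ?q y * weight A B \<gamma> t y)
      = (LINT y:?S|lborel. c y * F' y)"
    by (intro set_lebesgue_integral_cong) (auto simp: F'_def c_def weight_eq algebra_simps)
  moreover have "(LINT y:?S|lborel. c y * F' y)
      = (LINT y:{..<t - \<epsilon>}|lborel. c y * F' y) + (LINT y:{t + \<epsilon><..}|lborel. c y * F' y)"
  proof -
    have int: "set_integrable lborel ?S (\<lambda>y. c y * F' y)"
    proof -
      have "set_integrable lborel ?S (\<lambda>y. \<gamma> * (poly f y * weight A B \<gamma> t y / (y - t)) - poly ?q y * weight A B \<gamma> t y)"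
        using int1' int2 by (rule set_integral_diff(1))
      moreover have "(\<lambda>y. \<gamma> * (poly f y * weight A B \<gamma> t y / (y - t)) - poly ?q y * weight A B \<gamma> t y)
          = (\<lambda>y. c y * F' y)"
        by (rule ext) (auto simp: F'_def c_def weight_eq algebra_simps)
      ultimately show ?thesis
        by simp
    qed
    show ?thesis
      unfolding S using \<open>\<epsilon> > 0\<close>
      by (intro set_integral_Un set_integrable_subset[OF int]) auto
  qed
  moreover have "(LINT y:{..<t - \<epsilon>}|lborel. c y * F' y) = (LINT y:{..<t - \<epsilon>}|lborel. A * F' y)"
    using \<open>\<epsilon> > 0\<close> by (intro set_lebesgue_integral_cong) (auto simp: c_def heaviside_def)
  moreover have "(LINT y:{t + \<epsilon><..}|lborel. c y * F' y) = (LINT y:{t + \<epsilon><..}|lborel. (A + B) * F' y)"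
    using \<open>\<epsilon> > 0\<close> by (intro set_lebesgue_integral_cong) (auto simp: c_def heaviside_def)
  ultimately show ?thesis
    using parts(2,3) by simp
qed

lemma gauss_powr_at:
  "\<epsilon> > 0 \<Longrightarrow> gauss_powr \<gamma> t (t - \<epsilon>) = exp (- (t - \<epsilon>)\<^sup>2 + t * (t - \<epsilon>)) * \<epsilon> powr \<gamma>"
  "\<epsilon> > 0 \<Longrightarrow> gauss_powr \<gamma> t (t + \<epsilon>) = exp (- (t + \<epsilon>)\<^sup>2 + t * (t + \<epsilon>)) * \<epsilon> powr \<gamma>"
  by (simp_all add: gauss_powr_def)

text \<open>The expression is \<epsilon>^(\<gamma>+1) times a difference quotient, and \<gamma> + 1
  > 0. It lets boundary values near t be replaced by the value at t.\<close>

lemma tendsto_powr_mult_increment: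
  fixes k :: "real \<Rightarrow> real"
  assumes "(k has_real_derivative k') (at 0)" and "\<gamma> > -1"
  shows "((\<lambda>\<epsilon>. \<epsilon> powr \<gamma> * (k \<epsilon> - k 0)) \<longlongrightarrow> 0) (at_right 0)"
proof -
  have "((\<lambda>\<epsilon>. \<epsilon> powr (\<gamma> + 1)) \<longlongrightarrow> 0) (at_right 0)"
    using assms(2) by real_asymp
  moreover have "((\<lambda>\<epsilon>. (k \<epsilon> - k 0) / \<epsilon>) \<longlongrightarrow> k') (at_right 0)"
    using assms(1) by (simp add: has_field_derivative_iff filterlim_at_split)
  ultimately have "((\<lambda>\<epsilon>. \<epsilon> powr (\<gamma> + 1) * ((k \<epsilon> - k 0) / \<epsilon>)) \<longlongrightarrow> 0 * k') (at_right 0)"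
    by (rule tendsto_mult)
  moreover have "\<forall>\<^sub>F \<epsilon> in at_right 0. \<epsilon> powr (\<gamma> + 1) * ((k \<epsilon> - k 0) / \<epsilon>) = \<epsilon> powr \<gamma> * (k \<epsilon> - k 0)"
    using eventually_at_right_less[of "0 :: real"] by eventually_elim (simp add: powr_add)
  ultimately show ?thesis
    by (simp add: tendsto_cong)
qed

section \<open>The finite part and its consequences\<close>

text \<open>With all boundary values moved to t, the two boundary terms leave -B \<epsilon>^\<gamma>
  f(t), exactly what the added term compensates.\<close>

lemma finite_part_integral:
  fixes \<gamma> t :: real
  assumes "\<gamma> > -1"
  shows "((\<lambda>\<epsilon>. \<gamma> * (LINT y:{y. \<bar>y - t\<bar> > \<epsilon>}|lborel. poly f y * weight A B \<gamma> t y / (y - t))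
      + B * \<epsilon> powr \<gamma> * poly f t)
    \<longlongrightarrow> (LINT y|lborel. poly ([:- t, 2:] * f - pderiv f) y * weight A B \<gamma> t y)) (at_right 0)"
    (is "(?f \<longlongrightarrow> ?I) _")
proof -
  let ?q = "[:- t, 2:] * f - pderiv f"
  define k where "k x = poly f x * exp (- x\<^sup>2 + t * x)" for x
  have k: "\<exists>D. (k has_real_derivative D) (at x)" for x
    unfolding k_def by (rule exI) (rule derivative_eq_intros poly_DERIV refl)+
  obtain D where D: "(k has_real_derivative D) (at t)"
    using k by blast
  have "((\<lambda>\<epsilon>. k (t + \<epsilon>)) has_real_derivative D * 1) (at 0)"
    by (rule DERIV_chain2[where f = k]) (auto intro!: derivative_eq_intros D)
  then have lim1: "((\<lambda>\<epsilon>. \<epsilon> powr \<gamma> * (k (t + \<epsilon>) - k t)) \<longlongrightarrow> 0) (at_right 0)"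
    using tendsto_powr_mult_increment[OF _ assms, of "\<lambda>\<epsilon>. k (t + \<epsilon>)"] by simp
  have "((\<lambda>\<epsilon>. k (t - \<epsilon>)) has_real_derivative D * (-1)) (at 0)"
    by (rule DERIV_chain2[where f = k]) (auto intro!: derivative_eq_intros D)
  then have lim2: "((\<lambda>\<epsilon>. \<epsilon> powr \<gamma> * (k (t - \<epsilon>) - k t)) \<longlongrightarrow> 0) (at_right 0)"
    using tendsto_powr_mult_increment[OF _ assms, of "\<lambda>\<epsilon>. k (t - \<epsilon>)"] by simp
  have "((\<lambda>\<epsilon>. (LINT y:{y. \<bar>y - t\<bar> > \<epsilon>}|lborel. poly ?q y * weight A B \<gamma> t y)
      + A * (\<epsilon> powr \<gamma> * (k (t - \<epsilon>) - k t)) - (A + B) * (\<epsilon> powr \<gamma> * (k (t + \<epsilon>) - k t)))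
      \<longlongrightarrow> ?I + A * 0 - (A + B) * 0) (at_right 0)"
    by (intro tendsto_intros tendsto_set_integral_punctured integrable_poly_weight assms lim1 lim2)
  moreover have "\<forall>\<^sub>F \<epsilon> in at_right 0. ?f \<epsilon> =
      (LINT y:{y. \<bar>y - t\<bar> > \<epsilon>}|lborel. poly ?q y * weight A B \<gamma> t y)
      + A * (\<epsilon> powr \<gamma> * (k (t - \<epsilon>) - k t)) - (A + B) * (\<epsilon> powr \<gamma> * (k (t + \<epsilon>) - k t))"
    using eventually_at_right_less[of "0 :: real"]
  proof eventually_elim
    case (elim \<epsilon>)
    \<comment> \<open>The Gaussian exponent -y^2 + t y vanishes at y = t.\<close>
    have "k t = poly f t"
      by (simp add: k_def power2_eq_square)
    then show ?case
      by (simp only: truncated_integration_by_parts[OF assms elim] gauss_powr_at[OF elim])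
        (simp add: k_def algebra_simps)
  qed
  ultimately show ?thesis
    by (simp add: tendsto_cong)
qed


text \<open>For (y - t) f the kernel cancels and the correction term vanishes at t, so the finite
  part is an ordinary integral; uniqueness of limits gives the identity.\<close>

lemma pearson_weight:
  fixes \<gamma> t :: real
  assumes "\<gamma> > -1"
  shows "(LINT y|lborel. poly ([:- t, 2:] * ([:- t, 1:] * f) - pderiv ([:- t, 1:] * f)) y * weight A B \<gamma> t y)
    = \<gamma> * (LINT y|lborel. poly f y * weight A B \<gamma> t y)"
    (is "?I = _")
proof -
  have cancel: "(LINT y:{y. \<bar>y - t\<bar> > \<epsilon>}|lborel. poly ([:- t, 1:] * f) y * weight A B \<gamma> t y / (y - t))
      = (LINT y:{y. \<bar>y - t\<bar> > \<epsilon>}|lborel. poly f y * weight A B \<gamma> t y)" if "\<epsilon> > 0" for \<epsilon>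
    using that by (intro set_lebesgue_integral_cong) (auto simp: field_simps)
  have "((\<lambda>\<epsilon>. \<gamma> * (LINT y:{y. \<bar>y - t\<bar> > \<epsilon>}|lborel. poly f y * weight A B \<gamma> t y)) \<longlongrightarrow> ?I) (at_right 0)"
  proof (rule Lim_transform_eventually[OF finite_part_integral[OF assms]])
    show "\<forall>\<^sub>F \<epsilon> in at_right 0.
      \<gamma> * (LINT y:{y. \<bar>y - t\<bar> > \<epsilon>}|lborel. poly ([:- t, 1:] * f) y * weight A B \<gamma> t y / (y - t))
        + B * \<epsilon> powr \<gamma> * poly ([:- t, 1:] * f) t
      = \<gamma> * (LINT y:{y. \<bar>y - t\<bar> > \<epsilon>}|lborel. poly f y * weight A B \<gamma> t y)"
      using eventually_at_right_less[of "0 :: real"] by eventually_elim (simp only: cancel, simp)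
  qed
  moreover have "((\<lambda>\<epsilon>. \<gamma> * (LINT y:{y. \<bar>y - t\<bar> > \<epsilon>}|lborel. poly f y * weight A B \<gamma> t y))
      \<longlongrightarrow> \<gamma> * (LINT y|lborel. poly f y * weight A B \<gamma> t y)) (at_right 0)"
    by (intro tendsto_intros tendsto_set_integral_punctured integrable_poly_weight assms)
  ultimately show ?thesis
    by (rule tendsto_unique[rotated]) simp
qed

text \<open>|y - t|^\<gamma> / (y - t) = |y - t|^(\<gamma>-1) sgn(y - t), and \<gamma> - 1 >
  -1.\<close>

lemma integrable_poly_weight_div:
  fixes \<gamma> t :: real
  assumes "\<gamma> > 0"
  shows "integrable lborel (\<lambda>y. poly f y * weight A B \<gamma> t y / (y - t))"
proof -
  have "integrable lborel (\<lambda>y. poly f y * gauss_powr (\<gamma> - 1) t y * ((A + B * heaviside (y - t)) * sgn (y - t)))"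
  proof (rule integrable_bounded_mult)
    show "\<bar>(A + B * heaviside (x - t)) * sgn (x - t)\<bar> \<le> \<bar>A\<bar> + \<bar>B\<bar>" for x
      using abs_weight_factor_le[of A B "x - t"] by (auto simp: sgn_real_def)
  qed (use assms in \<open>auto intro!: integrable_poly_gauss_powr simp: heaviside_def[abs_def]\<close>)
  moreover have "poly f y * gauss_powr (\<gamma> - 1) t y * ((A + B * heaviside (y - t)) * sgn (y - t))
      = poly f y * weight A B \<gamma> t y / (y - t)" for y
    by (cases y t rule: linorder_cases) (auto simp: weight_eq gauss_powr_def powr_diff field_simps)
  ultimately show ?thesis
    by simp
qed

text \<open>Both branches of the definition yield the same moment expression: for \<gamma> > 0 the
  correction \<epsilon>^\<gamma> tends to 0 and the truncated integrals converge, otherwise the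
  defining limit is the one already computed.\<close>

lemma R_coeff_eq:
  fixes \<gamma> t :: real
  assumes "\<gamma> > -1"
  shows "R_coeff A B \<gamma> t P h n
    = (LINT y|lborel. poly ([:- t, 2:] * (P n * P n) - pderiv (P n * P n)) y * weight A B \<gamma> t y) / h n"
    (is "_ = ?I / _")
proof -
  have sq: "poly (P n * P n) y = (poly (P n) y)\<^sup>2" for y
    by (simp add: power2_eq_square)
  note lim = finite_part_integral[OF assms, of t "P n * P n" A B, unfolded sq]
  show ?thesis
  proof (cases "\<gamma> > 0")
    case True
    have "((\<lambda>\<epsilon>. \<gamma> * (LINT y:{y. \<bar>y - t\<bar> > \<epsilon>}|lborel. (poly (P n) y)\<^sup>2 * weight A B \<gamma> t y / (y - t))
        + B * \<epsilon> powr \<gamma> * (poly (P n) t)\<^sup>2)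
      \<longlongrightarrow> \<gamma> * (LINT y|lborel. (poly (P n) y)\<^sup>2 * weight A B \<gamma> t y / (y - t)) + B * 0 * (poly (P n) t)\<^sup>2)
      (at_right 0)"
    proof (intro tendsto_intros tendsto_set_integral_punctured)
      show "integrable lborel (\<lambda>y. (poly (P n) y)\<^sup>2 * weight A B \<gamma> t y / (y - t))"
        using integrable_poly_weight_div[OF True, of "P n * P n" A B t] unfolding sq .
      show "((\<lambda>\<epsilon>. \<epsilon> powr \<gamma>) \<longlongrightarrow> 0) (at_right 0)"
        using True by real_asymp
    qed
    then have "\<gamma> * (LINT y|lborel. (poly (P n) y)\<^sup>2 * weight A B \<gamma> t y / (y - t)) = ?I"
      using tendsto_unique[OF _ lim] by simp
    then show ?thesis
      using True by (simp add: R_coeff_def)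
  next
    case False
    then show ?thesis
      using tendsto_Lim[OF _ lim] by (simp add: R_coeff_def)
  qed
qed

section \<open>Nonvanishing norms and the conclusion\<close>

lemma integral_square_weight_nonzero:
  fixes \<gamma> t :: real
  assumes "\<gamma> > -1" and "A \<ge> 0" and "A + B \<ge> 0" and "A \<noteq> 0 \<or> A + B \<noteq> 0" and "p \<noteq> 0"
  shows "(LINT y|lborel. poly p y * poly p y * weight A B \<gamma> t y) \<noteq> 0"
proof
  assume "(LINT y|lborel. poly p y * poly p y * weight A B \<gamma> t y) = 0"
  moreover have "integrable lborel (\<lambda>y. poly p y * poly p y * weight A B \<gamma> t y)"
    using integrable_poly_weight[OF assms(1), of "p * p" A B t] by simp
  moreover have "0 \<le> poly p y * poly p y * weight A B \<gamma> t y" for y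
    using assms(2,3) by (auto simp: weight_def heaviside_def)
  ultimately have "AE y in lborel. poly p y * poly p y * weight A B \<gamma> t y = 0"
    by (subst integral_nonneg_eq_0_iff_AE[symmetric]) auto
  moreover have "AE y in lborel. poly p y \<noteq> 0"
    using finite_imp_null_set_lborel[OF poly_roots_finite[OF assms(5)]] by (rule AE_I') simp
  ultimately have w: "AE y in lborel. weight A B \<gamma> t y = 0"
    by eventually_elim simp
  \<comment> \<open>A unit interval next to t on which the weight does not vanish: on the left if A
    + B = 0, on the right otherwise.\<close>
  obtain a where a: "\<And>y. y \<in> {a<..<a + 1} \<Longrightarrow> weight A B \<gamma> t y \<noteq> 0"
  proof (cases "A + B = 0")
    case True
    show ?thesis
      using True assms(4) by (intro that[of "t - 1"]) (auto simp: weight_def heaviside_def)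
  next
    case False
    show ?thesis
      using False by (intro that[of t]) (auto simp: weight_def heaviside_def)
  qed
  from w have "AE y in lborel. y \<notin> {a<..<a + 1}"
    by eventually_elim (use a in blast)
  moreover have "{y \<in> space lborel. \<not> y \<notin> {a<..<a + 1}} = {a<..<a + 1}"
    by auto
  ultimately have "emeasure lborel {a<..<a + 1} = 0"
    using AE_iff_measurable[of "{a<..<a + 1}" lborel "\<lambda>y. y \<notin> {a<..<a + 1}"] by simp
  then show False
    by simp
qed

theorem theorem5p3:
  fixes A B \<gamma> t :: real and P :: "nat \<Rightarrow> real poly" and h :: "nat \<Rightarrow> real" and n :: nat
  defines "\<sigma> \<equiv> sigma_hat A B \<gamma> t P h"
  assumes "A \<ge> 0" and "A + B \<ge> 0" and "\<gamma> > -1"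
    and "monic_orthogonal (weight A B \<gamma> t) P h"
    and "n \<ge> 1"
  shows "2 * (real n * \<sigma> (n - 1) + \<sigma> n - real n * \<sigma> (n + 1))\<^sup>2
         - 2 * \<gamma> * (real n * \<sigma> (n - 1) + \<sigma> n - real n * \<sigma> (n + 1)) * (t - \<sigma> (n - 1) + \<sigma> (n + 1))
       = (\<sigma> (n - 1) - \<sigma> n) * (\<sigma> n - \<sigma> (n + 1)) * (\<sigma> n + real n * t) * (\<sigma> (n + 1) - \<sigma> (n - 1) + t)"
proof (cases "A = 0 \<and> A + B = 0")
  case True
  \<comment> \<open>For the zero weight all \<open>h j\<close> are 0, and division by zero makes
    every R and \<sigma> equal to 0, so both sides vanish.\<close>
  then have "weight A B \<gamma> t z = 0" for z
    by (simp add: weight_def)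
  moreover have "h j = (LINT z|lborel. poly (P j) z * poly (P j) z * weight A B \<gamma> t z)" for j
    using assms(5) by (simp add: monic_orthogonal_def)
  ultimately have "h j = 0" for j
    by simp
  then have "R_coeff A B \<gamma> t P h j = 0" for j
    by (simp add: R_coeff_def)
  then have "\<sigma> k = 0" for k
    by (simp add: \<sigma>_def sigma_hat_def)
  then show ?thesis
    by simp
next
  case False
  define L where "L p = (LINT y|lborel. poly p y * weight A B \<gamma> t y)" for p
  have mono: "degree (P k) = k" "lead_coeff (P k) = 1" for k
    using assms(5) unfolding monic_orthogonal_def by blast+
  have orth: "(LINT z|lborel. poly (P j) z * poly (P i) z * weight A B \<gamma> t z) = (if i = j then h j else 0)" for i j
    using assms(5) by (simp add: monic_orthogonal_def)
  interpret semiclassical_functional L P h t \<gamma>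
  proof
    fix p q f :: "real poly" and c :: real and i j :: nat
    show "L (p + q) = L p + L q"
      using integrable_poly_weight[OF \<open>\<gamma> > -1\<close>] by (simp add: L_def distrib_right)
    show "L (smult c p) = c * L p"
      by (simp add: L_def mult.assoc)
    show "L (P i * P j) = (if i = j then h j else 0)"
      using orth[of i j] by (auto simp: L_def)
    show "L ([:- t, 2:] * ([:- t, 1:] * f) - pderiv ([:- t, 1:] * f)) = \<gamma> * L f"
      unfolding L_def by (rule pearson_weight[OF \<open>\<gamma> > -1\<close>])
  qed (rule mono)+
  have "P j \<noteq> 0" for j
    using mono(2)[of j] by auto
  then have "h j \<noteq> 0" for j
    using integral_square_weight_nonzero[of \<gamma> A B "P j" t] orth[of j j] False assms(2-4)
    by auto
  \<comment> \<open>By \<open>R_coeff_eq\<close> each R is \<open>D (P j * P j) / h j\<close> for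
    the functional \<open>L\<close> of this weight.\<close>
  moreover have "\<sigma> = (\<lambda>n. - (\<Sum>j<n. D (P j * P j) / h j))"
    unfolding \<sigma>_def sigma_hat_def R_coeff_eq[OF \<open>\<gamma> > -1\<close>] D_def L_def by (rule refl)
  ultimately show ?thesis
    using discrete_sigma_form[OF _ \<open>n \<ge> 1\<close>] by simp
qed

end
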